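(* (1) If $A\subseteq\mathbb{R}$ is a non-null $\mathbf{\Sigma}^1_1$ set and $f:\mathbb{R}\to\mathbb{R}$ is a continuous function mapping every null subset of $A$ to a countable set, then $f[A]$ is countable; in particular, if $A$ is an interval then $f$ restricted to $A$ is constant. (2) Assuming the Continuum Hypothesis, there is a function $f:\mathbb{R}\to\mathbb{R}$ mapping every null set to a countable set such that the range of $f$ is $\mathbb{R}$, $f(A)$ is uncountable for every non-null set $A$, and for every $y$ the set $f^{-1}(y)$ is an uncountable Borel null set. (3) If $A\subseteq\mathbb{R}$ is a non-null set and $f:\mathbb{R}\to\mathbb{R}$ is a continuous function mapping every null subset of $A$ to a meager set, then $f[A]$ is meager; in particular, if $A$ is an interval then $f$ restricted to $A$ is constant. (4) If $f:\mathbb{R}\to\mathbb{R}$ is Lebesgue measurable and maps every null set to a meager set, then the range of $f$ is meager; in particular, if $f$ is continuous with this property then $f$ is constant. (5) If $f:\mathbb{R}\to\mathbb{R}$ has the Baire property and maps every meager set to a null set, then the range of $f$ is null; in particular, if $f$ is continuous with this property then $f$ is constant.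
   Context: "Null" refers to Lebesgue measure zero; $\mathbf{\Sigma}^1_1$ denotes (boldface) analytic sets. *)

theory Defs
  imports "HOL-Analysis.Analysis"
begin

text \<open>
  Boldface \<open>\<Sigma>\<close>-1-1 sets, as projections of closed subsets of the product with Baire space.
  The type \<^typ>\<open>nat \<Rightarrow> nat\<close> carries the product topology of the discrete topology on
  \<^typ>\<open>nat\<close>.
\<close>

definition analytic_set :: "'a::polish_space set \<Rightarrow> bool" where
  "analytic_set A \<longleftrightarrow> (\<exists>F :: ('a \<times> (nat \<Rightarrow> nat)) set. closed F \<and> A = fst ` F)"

definition nowhere_dense :: "'a::topological_space set \<Rightarrow> bool" where
  "nowhere_dense A \<longleftrightarrow> interior (closure A) = {}"

definition meager :: "'a::topological_space set \<Rightarrow> bool" where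
  "meager A \<longleftrightarrow> (\<exists>N :: nat \<Rightarrow> 'a set. (\<forall>n. nowhere_dense (N n)) \<and> A = (\<Union>n. N n))"

definition baire_property :: "'a::topological_space set \<Rightarrow> bool" where
  "baire_property A \<longleftrightarrow> (\<exists>U. open U \<and> meager ((A - U) \<union> (U - A)))"

definition baire_property_fun :: "('a::topological_space \<Rightarrow> 'b::topological_space) \<Rightarrow> bool" where
  "baire_property_fun f \<longleftrightarrow> (\<forall>U. open U \<longrightarrow> baire_property (f -` U))"

unbundle cardinal_syntax

text \<open>
  CH: the cardinal power of 2 to \<open>\<aleph>\<close>-0 is \<open>\<aleph>\<close>-1. Here \<^const>\<open>natLeq\<close> plays the role of
  \<open>\<aleph>\<close>-0 and \<^const>\<open>cardSuc\<close> is the cardinal successor.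
\<close>

definition continuum_hypothesis :: bool where
  "continuum_hypothesis \<longleftrightarrow> ctwo ^c natLeq =o cardSuc natLeq"

unbundle no cardinal_syntax

end

theory Submission
  imports Defs "HOL-Library.Countable_Set_Type" begin

text \<open>
  Parts (3)--(5) move a null or meager set across \<open>f\<close>. For measurable \<open>f\<close>, push Lebesgue measure on
  a bounded interval forward: the resulting finite measure has only countably many atoms, so it gives
  measure zero to some countable dense set, hence by outer regularity to a comeager set \<open>B\<close>; then
  \<open>f\<close> maps the null set \<open>A \<inter> f -` B\<close> to a meager set, and the rest of the image lies outside \<open>B\<close>.
  For \<open>f\<close> with the Baire property, \<open>f\<close> is continuous on a comeager set \<open>C\<close>; for \<open>T\<close> countable and dense
  in \<open>C\<close>, a null \<open>G\<^sub>\<delta>\<close> set around \<open>f ` T\<close> has comeager preimage.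

  Part (1): let \<open>F\<close> be a closed set projecting onto \<open>A\<close>, and remove from it every basic open set on which
  the lifted \<open>f\<close> has countable range. What remains is a closed \<open>K\<close> such that \<open>f\<close> is not constant on
  any nonempty relatively open subset. Cover the projection of a countable dense subset of \<open>K\<close> by a
  null \<open>G\<^sub>\<delta>\<close> set \<open>E\<close>. If \<open>f\<close> had countable range over \<open>E\<close>, then \<open>K\<close> would be a countable union of closed
  nowhere dense sets, contradicting the Baire category theorem unless \<open>K\<close> is empty.

  Part (2): under CH a cofinal family of null \<open>G\<^sub>\<delta>\<close> sets is well-ordered with countable initial
  segments. Disjointifying it splits the line into Borel null sets such that each null set meets only
  countably many; uncountably many of the pieces are uncountable, and merging each piece into the next
  uncountable one makes all of them uncountable. The function sends distinct pieces to distinct reals.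
\<close>

section \<open>Meager sets and the Baire category theorem\<close>

lemma nowhere_dense_subset:
  assumes "nowhere_dense B" "A \<subseteq> B" shows "nowhere_dense A"
  using assms unfolding nowhere_dense_def
  by (metis closure_mono interior_mono subset_empty)

text \<open>Replacing the exact union by a cover with closed sets makes heredity immediate and fits
  the hypotheses of the Baire category theorem.\<close>

lemma meager_iff_cover:
  "meager A \<longleftrightarrow> (\<exists>N :: nat \<Rightarrow> 'a::topological_space set. (\<forall>n. closed (N n) \<and> interior (N n) = {}) \<and> A \<subseteq> (\<Union>n. N n))"
  (is "_ \<longleftrightarrow> ?R")
proof
  assume "meager A"
  then obtain N :: "nat \<Rightarrow> 'a set" where "\<forall>n. nowhere_dense (N n)" "A = (\<Union>n. N n)"
    unfolding meager_def by blast
  then show ?R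
    unfolding nowhere_dense_def
    by (intro exI[of _ "\<lambda>n. closure (N n)"]) (use closure_subset in force)
next
  assume ?R
  then obtain N :: "nat \<Rightarrow> 'a set"
    where N: "\<forall>n. closed (N n) \<and> interior (N n) = {}" "A \<subseteq> (\<Union>n. N n)"
    by blast
  then have "\<forall>n. nowhere_dense (A \<inter> N n)"
    by (metis nowhere_dense_subset nowhere_dense_def closure_closed Int_lower2)
  with N(2) show "meager A"
    unfolding meager_def by (intro exI[of _ "\<lambda>n. A \<inter> N n"]) blast
qed

lemma meager_subset:
  assumes "meager B" "A \<subseteq> B" shows "meager A"
  using assms unfolding meager_iff_cover by (metis subset_trans)

lemma meager_Union:
  assumes "countable \<F>" and F: "\<And>F. F \<in> \<F> \<Longrightarrow> meager F"
  shows "meager (\<Union>\<F> :: 'a::topological_space set)"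
proof -
  have "\<forall>F\<in>\<F>. \<exists>N :: nat \<Rightarrow> 'a set. (\<forall>n. nowhere_dense (N n)) \<and> F = (\<Union>n. N n)"
    using F unfolding meager_def by blast
  then obtain N :: "'a set \<Rightarrow> nat \<Rightarrow> 'a set"
    where N: "\<And>F n. F \<in> \<F> \<Longrightarrow> nowhere_dense (N F n)" "\<And>F. F \<in> \<F> \<Longrightarrow> F = (\<Union>n. N F n)"
    by metis
  \<comment> \<open>Adding \<open>{}\<close> keeps the family nonempty even for empty
    \<open>\<F>\<close>, so that \<open>from_nat_into\<close> enumerates exactly this
    family.\<close>
  let ?\<N> = "insert {} (case_prod N ` (\<F> \<times> UNIV))"
  have "nowhere_dense ({} :: 'a set)"
    by (simp add: nowhere_dense_def)
  then have "nowhere_dense A" if "A \<in> ?\<N>" for A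
    using that N(1) by auto
  moreover have "range (from_nat_into ?\<N>) = ?\<N>"
    using assms(1) by (intro range_from_nat_into) auto
  moreover have "\<Union>\<F> = \<Union>?\<N>"
  proof -
    have "\<Union>\<F> = (\<Union>F\<in>\<F>. \<Union>n. N F n)"
      using N(2) by (metis (no_types, lifting) image_cong image_ident)
    then show ?thesis by auto
  qed
  ultimately show ?thesis
    unfolding meager_def
    by (intro exI[of _ "from_nat_into ?\<N>"]) (metis rangeI)
qed

lemma meager_Un:
  assumes "meager A" "meager B" shows "meager (A \<union> B)"
  using meager_Union[of "{A, B}"] assms by auto

lemma nowhere_dense_Compl:
  assumes "open U" "closure U = UNIV" shows "nowhere_dense (- U)"
  using assms by (simp add: nowhere_dense_def interior_complement closure_closed closed_Compl)

lemma interior_meager: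
  fixes A :: "'a::complete_space set"
  assumes "meager A" shows "interior A = {}"
proof -
  obtain N :: "nat \<Rightarrow> 'a set" where N: "\<forall>n. closed (N n) \<and> interior (N n) = {}" "A \<subseteq> (\<Union>n. N n)"
    using assms unfolding meager_iff_cover by blast
  have "euclidean interior_of \<Union>(range N) = {}"
    using N by (intro Baire_category_alt) (auto simp: completely_metrizable_space_euclidean)
  with N(2) show ?thesis
    by simp (metis interior_mono subset_empty)
qed

section \<open>Constancy on intervals\<close>

lemma connected_real_cases:
  fixes S :: "real set"
  assumes "connected S"
  obtains c where "S \<subseteq> {c}" | a b where "a < b" "{a<..<b} \<subseteq> S"
proof (cases "\<exists>a\<in>S. \<exists>b\<in>S. a < b")
  case True
  then obtain a b where "a \<in> S" "b \<in> S" "a < b" by blast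
  then show ?thesis
    using that(2)[of a b] connected_contains_Icc[OF assms] by force
next
  case False
  then have "S \<subseteq> {SOME s. s \<in> S}"
    by (metis insertI1 linorder_neqE_linordered_idom someI subsetI)
  then show ?thesis using that(1) by blast
qed

text \<open>The image is connected, and without interior points it cannot contain an open interval.
  Countable, null and meager images all qualify, which yields every constancy claim of the
  theorem.\<close>

lemma continuous_constant_on_interval:
  fixes f :: "real \<Rightarrow> real"
  assumes "continuous_on UNIV f" "is_interval A" "interior (f ` A) = {}"
  shows "f constant_on A"
proof -
  have "connected (f ` A)"
    using assms(1,2) by (meson connected_continuous_image continuous_on_subset is_interval_connected subset_UNIV)
  then show ?thesis
  proof (cases rule: connected_real_cases)
    case (1 c)
    then have "\<forall>x\<in>A. f x = c" by blast
    then show ?thesis unfolding constant_on_def by blast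
  next
    case (2 a b)
    then have "{a<..<b} \<subseteq> interior (f ` A)"
      by (simp add: interior_maximal)
    with \<open>a < b\<close> assms(3) show ?thesis by simp
  qed
qed

section \<open>Lebesgue null sets and their open covers\<close>

lemma interior_null_set:
  fixes S :: "'a::euclidean_space set"
  assumes "S \<in> null_sets lebesgue" shows "interior S = {}"
proof -
  have "negligible (interior S)"
    using assms interior_subset negligible_iff_null_sets negligible_subset by blast
  then show ?thesis
    using open_not_negligible by blast
qed

lemma countable_imp_null_set:
  fixes S :: "'a::euclidean_space set"
  assumes "countable S" shows "S \<in> null_sets lebesgue"
  using countable_imp_null_set_lborel[OF assms] by (rule null_sets_completionI)

lemma ennreal_eq_0_if_le_inverse_Suc:
  assumes "\<And>k. x \<le> ennreal (1 / Suc k)" shows "x = 0"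
proof -
  have "(\<lambda>k. ennreal (1 / Suc k)) \<longlonglongrightarrow> ennreal 0"
    by (intro tendsto_ennrealI LIMSEQ_inverse_real_of_nat[unfolded inverse_eq_divide])
  then have "x \<le> ennreal 0"
    using assms by (intro LIMSEQ_le_const) auto
  then show ?thesis by simp
qed

text \<open>The open sets stay available as a sequence because category arguments treat each one
  separately: its preimage has a nowhere dense complement, relative to a suitable space.\<close>

lemma null_set_gdelta_cover:
  fixes N :: "'a::euclidean_space set"
  assumes "N \<in> null_sets lebesgue"
  shows "\<exists>V :: nat \<Rightarrow> 'a set. (\<forall>k. open (V k) \<and> N \<subseteq> V k) \<and> (\<Inter>k. V k) \<in> null_sets lebesgue"
proof -
  have "\<exists>U. open U \<and> N \<subseteq> U \<and> emeasure lebesgue U < ennreal (1 / Suc k)" for k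
  proof -
    obtain U where U: "open U" "N \<subseteq> U" "emeasure lebesgue (U - N) < ennreal (1 / Suc k)"
      by (rule sets_lebesgue_outer_open[of N "1 / Suc k"]) (use assms in auto)
    then show ?thesis
      using emeasure_Diff_null_set[OF assms, of U] by auto
  qed
  then obtain V where V: "\<And>k::nat. open (V k)" "\<And>k. N \<subseteq> V k"
    "\<And>k. emeasure lebesgue (V k) < ennreal (1 / Suc k)"
    by metis
  have "emeasure lebesgue (\<Inter>k. V k) \<le> ennreal (1 / Suc k)" for k
  proof -
    have "emeasure lebesgue (\<Inter>k. V k) \<le> emeasure lebesgue (V k)"
      by (rule emeasure_mono) (use V(1)[of k] in \<open>auto simp: lborelD\<close>)
    also have "\<dots> \<le> ennreal (1 / Suc k)"
      using V(3)[of k] by (rule less_imp_le)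
    finally show ?thesis .
  qed
  then have "emeasure lebesgue (\<Inter>k. V k) = 0"
    by (rule ennreal_eq_0_if_le_inverse_Suc)
  moreover have "(\<Inter>k. V k) \<in> sets lebesgue"
    using V(1) by (intro sets.countable_INT) auto
  ultimately show ?thesis
    using V(1,2) by (intro exI[of _ V]) (simp add: null_sets_def)
qed

section \<open>Maps exchanging measure and category\<close>

lemma meager_Compl_INT_open_dense:
  fixes V :: "nat \<Rightarrow> 'a::topological_space set"
  assumes "\<And>k. open (V k)" "\<And>k. T \<subseteq> V k" "closure T = UNIV"
  shows "meager (- (\<Inter>k. V k))"
proof -
  have "nowhere_dense (- V k)" for k
    using assms(1) closure_mono[OF assms(2)[of k]] assms(3)
    by (intro nowhere_dense_Compl) auto
  then show ?thesis
    unfolding meager_def by (intro exI[of _ "\<lambda>k. - V k"]) auto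
qed

lemma finite_measure_comeager_null:
  fixes M :: "real measure"
  assumes fin: "finite_measure M" and sets: "sets M = sets borel"
  obtains B where "B \<in> null_sets M" "meager (- B)"
proof -
  interpret finite_measure M by fact
  define C where "C = {x. measure M {x} \<noteq> 0}"
  have C: "countable C"
    unfolding C_def by (rule countable_support)
  obtain T where T: "countable T" "T \<subseteq> - C" "- C \<subseteq> closure T"
    using separable by blast
  \<comment> \<open>The set \<open>C\<close> of atoms is countable, hence Lebesgue null and without
    interior. So \<open>- C\<close> is dense, and \<open>T\<close> with it.\<close>
  have "interior C = {}"
    using C by (intro interior_null_set countable_imp_null_set)
  then have dense: "closure T = UNIV"
    using closure_mono[OF T(3)] by (simp add: closure_complement top.extremum_uniqueI)
  have "T = (\<Union>x\<in>T. {x})" by auto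
  moreover have "{x} \<in> null_sets M" if "x \<in> T" for x
    using that T(2) sets by (intro null_setsI) (auto simp: C_def emeasure_eq_measure)
  ultimately have null: "T \<in> null_sets M"
    using null_sets_UN'[OF T(1), of "\<lambda>x. {x}" M] by auto
  have "\<exists>U. open U \<and> T \<subseteq> U \<and> emeasure M U < ennreal (1 / Suc k)" for k
  proof -
    \<comment> \<open>Outer regularity is used for \<open>M\<close> itself, which may be unrelated
      to Lebesgue measure.\<close>
    have "emeasure M T = (INF U\<in>{U. T \<subseteq> U \<and> open U}. emeasure M U)"
      using null sets emeasure_finite by (intro outer_regular) auto
    then have "(INF U\<in>{U. T \<subseteq> U \<and> open U}. emeasure M U) < ennreal (1 / Suc k)"
      using null by (metis ennreal_less_zero_iff null_setsD1 of_nat_0_less_iff zero_less_Suc zero_less_divide_1_iff)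
    then show ?thesis
      unfolding INF_less_iff by blast
  qed
  then obtain V where V: "\<And>k::nat. open (V k)" "\<And>k. T \<subseteq> V k"
    "\<And>k. emeasure M (V k) < ennreal (1 / Suc k)"
    by metis
  have "emeasure M (\<Inter>k. V k) \<le> ennreal (1 / Suc k)" for k
  proof -
    have "emeasure M (\<Inter>k. V k) \<le> emeasure M (V k)"
      by (rule emeasure_mono) (use V(1)[of k] in \<open>auto simp: sets\<close>)
    also have "\<dots> \<le> ennreal (1 / Suc k)"
      using V(3)[of k] by (rule less_imp_le)
    finally show ?thesis .
  qed
  then have "emeasure M (\<Inter>k. V k) = 0"
    by (rule ennreal_eq_0_if_le_inverse_Suc)
  moreover have "(\<Inter>k. V k) \<in> sets M"
    using V(1) sets by (intro sets.countable_INT) auto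
  moreover have "meager (- (\<Inter>k. V k))"
    using V(1,2) dense by (rule meager_Compl_INT_open_dense)
  ultimately show ?thesis
    using that by (auto simp: null_sets_def)
qed

text \<open>Bounded intervals keep the pushforward finite, and countably many of them suffice.
  \<open>A\<close> may be non-measurable: completeness of Lebesgue measure makes its part inside a
  null preimage null.\<close>

lemma meager_image_of_null_to_meager:
  fixes f :: "real \<Rightarrow> real"
  assumes f: "f \<in> borel_measurable lebesgue"
    and null: "\<And>N. N \<subseteq> A \<Longrightarrow> N \<in> null_sets lebesgue \<Longrightarrow> meager (f ` N)"
  shows "meager (f ` A)"
proof -
  have part: "meager (f ` (A \<inter> {- real n..real n}))" for n
  proof -
    let ?I = "{- real n..real n}"
    define M where "M = distr (restrict_space lebesgue ?I) borel f"
    have fI: "f \<in> borel_measurable (restrict_space lebesgue ?I)"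
      using f by (rule measurable_restrict_space1)
    have "finite_measure (restrict_space lebesgue ?I)"
      by (intro finite_measure_lebesgue_on lmeasurable_interval)
    then have "finite_measure M"
      unfolding M_def by (rule finite_measure.finite_measure_distr) (rule fI)
    then obtain B where B: "B \<in> null_sets M" "meager (- B)"
      using finite_measure_comeager_null[of M] by (auto simp: M_def)
    have "f -` B \<inter> ?I \<in> null_sets (restrict_space lebesgue ?I)"
      using B(1) fI unfolding M_def by (simp add: null_sets_distr_iff space_restrict_space)
    then have "f -` B \<inter> ?I \<in> null_sets lebesgue"
      by (subst (asm) null_sets_restrict_space) auto
    then have "f -` B \<inter> ?I \<inter> A \<in> null_sets lebesgue"
      by (rule null_sets_completion_subset[rotated]) blast
    then have "meager (f ` (f -` B \<inter> ?I \<inter> A))"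
      by (intro null) auto
    then have "meager (f ` (f -` B \<inter> ?I \<inter> A) \<union> - B)"
      using B(2) by (rule meager_Un)
    then show ?thesis
      by (rule meager_subset) auto
  qed
  have "\<exists>n. x \<in> {- real n..real n}" for x
    using real_arch_simple[of "\<bar>x\<bar>"] by (auto simp: abs_le_iff minus_le_iff)
  then have "f ` A \<subseteq> (\<Union>n. f ` (A \<inter> {- real n..real n}))"
    by blast
  moreover have "meager (\<Union>n. f ` (A \<inter> {- real n..real n}))"
    using part by (intro meager_Union) auto
  ultimately show ?thesis
    by (rule meager_subset[rotated])
qed

lemma null_range_of_meager_to_null:
  fixes f :: "'a::polish_space \<Rightarrow> 'b::euclidean_space"
  assumes f: "baire_property_fun f"
    and meager: "\<And>M. meager M \<Longrightarrow> f ` M \<in> null_sets lebesgue"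
  shows "range f \<in> null_sets lebesgue"
proof -
  obtain \<B> :: "'b set set" where \<B>: "countable \<B>" "topological_basis \<B>"
    using ex_countable_basis by blast
  have "\<exists>U. open U \<and> meager ((f -` V - U) \<union> (U - f -` V))" if "V \<in> \<B>" for V
    using f that \<B>(2) unfolding baire_property_fun_def baire_property_def
    by (meson topological_basis_open)
  then obtain U where U: "\<And>V. V \<in> \<B> \<Longrightarrow> open (U V)"
    "\<And>V. V \<in> \<B> \<Longrightarrow> meager ((f -` V - U V) \<union> (U V - f -` V))"
    by metis
  \<comment> \<open>\<open>P\<close> gathers the errors over a countable basis, so it is meager and
    \<open>f\<close> is continuous on its complement.\<close>
  define P where "P = (\<Union>V\<in>\<B>. (f -` V - U V) \<union> (U V - f -` V))"
  have P: "meager P"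
    unfolding P_def using U(2) \<B>(1) by (intro meager_Union) auto
  have preimage: "\<exists>W. open W \<and> W - P = f -` V - P" if "open V" for V
  proof -
    obtain \<V> where "\<V> \<subseteq> \<B>" "\<Union>\<V> = V"
      using \<open>open V\<close> \<B>(2) unfolding topological_basis_def by metis
    then show ?thesis
      using U(1) unfolding P_def by (intro exI[of _ "\<Union>(U ` \<V>)"]) blast
  qed
  obtain T where T: "countable T" "T \<subseteq> - P" "- P \<subseteq> closure T"
    using separable by blast
  have dense: "closure T = UNIV"
    using closure_mono[OF T(3)] interior_meager[OF P]
    by (simp add: closure_complement top.extremum_uniqueI)
  have null_T: "f ` T \<in> null_sets lebesgue"
    using T(1) by (intro countable_imp_null_set countable_image)
  obtain V :: "nat \<Rightarrow> 'b set"
    where V: "\<And>k. open (V k)" "\<And>k. f ` T \<subseteq> V k" "(\<Inter>k. V k) \<in> null_sets lebesgue"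
    using null_set_gdelta_cover[OF null_T] by blast
  have "\<exists>W. open W \<and> W - P = f -` V k - P" for k
    using V(1) by (rule preimage)
  then obtain W where W: "\<And>k. open (W k)" "\<And>k. W k - P = f -` V k - P"
    by metis
  have "T \<subseteq> W k" for k
    using T(2) V(2)[of k] W(2)[of k] by blast
  with W(1) have "meager (- (\<Inter>k. W k))"
    using dense by (rule meager_Compl_INT_open_dense)
  then have "meager (- (\<Inter>k. W k) \<union> P)"
    using P by (rule meager_Un)
  \<comment> \<open>Off \<open>P\<close>, membership in \<open>W k\<close> means having the value in
    \<open>V k\<close>.\<close>
  moreover have "- f -` (\<Inter>k. V k) \<subseteq> - (\<Inter>k. W k) \<union> P"
    using W(2) by blast
  ultimately have "f ` (- f -` (\<Inter>k. V k)) \<in> null_sets lebesgue"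
    by (intro meager) (rule meager_subset)
  with V(3) have "(\<Inter>k. V k) \<union> f ` (- f -` (\<Inter>k. V k)) \<in> null_sets lebesgue"
    by (rule null_sets.Un)
  then show ?thesis
    by (rule null_sets_completion_subset[rotated]) auto
qed

section \<open>Countable images of analytic sets\<close>

text \<open>The map \<open>p\<close> tests nullness while \<open>g\<close> supplies the values to be
  counted. Taking \<open>fst\<close> and \<open>f \<circ> fst\<close> handles analytic sets; taking
  \<open>id\<close> twice produces uncountable null subsets of uncountable closed sets.\<close>

lemma countable_image_of_null_preimages:
  fixes p :: "'a::second_countable_topology \<Rightarrow> 'b::euclidean_space" and g :: "'a \<Rightarrow> 'c::t1_space"
  assumes complete: "completely_metrizable_space (euclidean :: 'a topology)"
    and F: "closed F" and p: "continuous_on F p" and g: "continuous_on F g"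
    and null: "\<And>N. N \<in> null_sets lebesgue \<Longrightarrow> countable (g ` {z \<in> F. p z \<in> N})"
  shows "countable (g ` F)"
proof -
  obtain \<B> :: "'a set set" where \<B>: "countable \<B>" "topological_basis \<B>"
    using ex_countable_basis by blast
  define W where "W = \<Union>{U \<in> \<B>. countable (g ` (F \<inter> U))}"
  define K where "K = F - W"
  have W: "countable (g ` (F \<inter> W))"
  proof -
    have "g ` (F \<inter> W) = (\<Union>U\<in>{U \<in> \<B>. countable (g ` (F \<inter> U))}. g ` (F \<inter> U))"
      unfolding W_def by blast
    then show ?thesis using \<B>(1) by auto
  qed
  have "open W"
    unfolding W_def using \<B>(2) by (intro open_Union) (auto dest: topological_basis_open)
  then have K: "closed K" "K \<subseteq> F"
    unfolding K_def using F by auto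
  define T where "T = (\<lambda>U. SOME x. x \<in> K \<inter> U) ` {U \<in> \<B>. K \<inter> U \<noteq> {}}"
  have some: "(SOME x. x \<in> K \<inter> U) \<in> K \<inter> U" if "K \<inter> U \<noteq> {}" for U
    using that by (meson ex_in_conv someI_ex)
  have T: "countable T" "T \<subseteq> K"
    unfolding T_def using \<B>(1) some by auto
  have dense: "K \<inter> O' = {}" if "open O'" "T \<inter> O' = {}" for O'
  proof (rule ccontr)
    assume "K \<inter> O' \<noteq> {}"
    then obtain x where x: "x \<in> K" "x \<in> O'" by blast
    obtain U where U: "U \<in> \<B>" "x \<in> U" "U \<subseteq> O'"
      by (rule topological_basisE[OF \<B>(2) \<open>open O'\<close> x(2)])
    then have "(SOME x. x \<in> K \<inter> U) \<in> T \<inter> O'"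
      using some[of U] x(1) unfolding T_def by blast
    with that(2) show False by blast
  qed
  have null_T: "p ` T \<in> null_sets lebesgue"
    using T(1) by (intro countable_imp_null_set countable_image)
  obtain V :: "nat \<Rightarrow> 'b set"
    where V: "\<And>k. open (V k)" "\<And>k. p ` T \<subseteq> V k" "(\<Inter>k. V k) \<in> null_sets lebesgue"
    using null_set_gdelta_cover[OF null_T] by blast
  define Q where "Q = g ` {z \<in> K. p z \<in> (\<Inter>k. V k)}"
  have Q: "countable Q"
    using null[OF V(3)] by (rule countable_subset[rotated]) (use K(2) in \<open>auto simp: Q_def\<close>)
  \<comment> \<open>Points of \<open>K\<close> projecting outside the null set lie in some set of
    the first kind; all others lie in a level set of \<open>g\<close> for one of the countably many
    values in \<open>Q\<close>.\<close>
  define \<G> where "\<G> = range (\<lambda>k. {z \<in> K. p z \<in> - V k}) \<union> (\<lambda>y. {z \<in> K. g z \<in> {y}}) ` Q"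
  have "top_of_set K interior_of \<Union>\<G> = {}"
  proof (rule Baire_category_alt)
    show "completely_metrizable_space (top_of_set K) \<or>
        locally_compact_space (top_of_set K) \<and> regular_space (top_of_set K)"
      using K(1) by (intro disjI1 completely_metrizable_space_closedin[OF complete]) simp
    show "countable \<G>"
      unfolding \<G>_def using Q by auto
  next
    fix S assume "S \<in> \<G>"
    then consider k where "S = {z \<in> K. p z \<in> - V k}" | y where "S = {z \<in> K. g z \<in> {y}}"
      unfolding \<G>_def by auto
    then have "closed S \<and> (\<forall>O'. open O' \<longrightarrow> K \<inter> O' \<subseteq> S \<longrightarrow> K \<inter> O' = {})"
    proof cases
      case (1 k)
      have "closed S"
        unfolding 1 using K p V(1)
        by (intro continuous_closed_preimage[unfolded vimage_def Int_def mem_Collect_eq])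
          (auto intro: continuous_on_subset)
      moreover have "K \<inter> O' = {}" if "open O'" "K \<inter> O' \<subseteq> S" for O'
      proof -
        have "T \<inter> O' = {}"
          using that(2) T(2) V(2)[of k] unfolding 1 by auto
        with that(1) show ?thesis by (rule dense)
      qed
      ultimately show ?thesis by blast
    next
      case (2 y)
      have "closed S"
        unfolding 2 using K g
        by (intro continuous_closed_preimage[unfolded vimage_def Int_def mem_Collect_eq])
          (auto intro: continuous_on_subset)
      moreover have "K \<inter> O' = {}" if "open O'" "K \<inter> O' \<subseteq> S" for O'
      proof (rule ccontr)
        assume "K \<inter> O' \<noteq> {}"
        then obtain x where x: "x \<in> K" "x \<in> O'" by blast
        obtain U where U: "U \<in> \<B>" "x \<in> U" "U \<subseteq> O'"
          by (rule topological_basisE[OF \<B>(2) \<open>open O'\<close> x(2)])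
        \<comment> \<open>On \<open>K \<inter> U\<close> the only value is \<open>y\<close>, and the
          rest of \<open>F \<inter> U\<close> lies in \<open>W\<close>. Hence \<open>U\<close> is
          one of the sets removed in forming \<open>K\<close>.\<close>
        have "g ` (F \<inter> U) \<subseteq> insert y (g ` (F \<inter> W))"
          using U(3) that(2) unfolding 2 K_def by auto
        then have "countable (g ` (F \<inter> U))"
          using W by (meson countable_insert countable_subset)
        then have "x \<in> W"
          using U unfolding W_def by blast
        then show False using x(1) unfolding K_def by blast
      qed
      ultimately show ?thesis by blast
    qed
    moreover have "S \<subseteq> K"
      using \<open>S \<in> \<G>\<close> unfolding \<G>_def by auto
    ultimately show "closedin (top_of_set K) S \<and> top_of_set K interior_of S = {}"
      unfolding interior_of_def openin_open
      by (auto simp: closed_subset)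
  qed
  moreover have "\<Union>\<G> = K"
    unfolding \<G>_def Q_def by auto
  ultimately have "K = {}"
    using interior_of_topspace[of "top_of_set K"] by simp
  then have "F \<inter> W = F"
    unfolding K_def by blast
  then show ?thesis using W by simp
qed

lemma countable_image_of_analytic:
  fixes f :: "'a::euclidean_space \<Rightarrow> 'b::t1_space"
  assumes "analytic_set A" "continuous_on A f"
    and null: "\<And>N. N \<subseteq> A \<Longrightarrow> N \<in> null_sets lebesgue \<Longrightarrow> countable (f ` N)"
  shows "countable (f ` A)"
proof -
  obtain F :: "('a \<times> (nat \<Rightarrow> nat)) set" where F: "closed F" "A = fst ` F"
    using assms(1) unfolding analytic_set_def by blast
  have "euclidean = discrete_topology (UNIV :: nat set)"
    by (simp add: topology_eq open_discrete)
  then have "completely_metrizable_space (euclidean :: nat topology)"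
    by (metis completely_metrizable_space_discrete_topology)
  then have "completely_metrizable_space (euclidean :: (nat \<Rightarrow> nat) topology)"
    by (simp add: completely_metrizable_space_product_topology flip: euclidean_product_topology)
  then have complete: "completely_metrizable_space (euclidean :: ('a \<times> (nat \<Rightarrow> nat)) topology)"
    by (simp add: completely_metrizable_space_prod_topology completely_metrizable_space_euclidean
        flip: prod_topology_euclidean)
  have "countable ((f \<circ> fst) ` F)"
  proof (rule countable_image_of_null_preimages[OF complete F(1)])
    show "continuous_on F fst" by (intro continuous_intros)
    then show "continuous_on F (f \<circ> fst)"
      using assms(2) F(2) by (intro continuous_on_compose) auto
    fix N :: "'a set" assume "N \<in> null_sets lebesgue"
    then have "A \<inter> N \<in> null_sets lebesgue"
      by (rule null_sets_completion_subset[rotated]) blast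
    then have "countable (f ` (A \<inter> N))"
      by (intro null) auto
    then show "countable ((f \<circ> fst) ` {z \<in> F. fst z \<in> N})"
      by (rule countable_subset[rotated]) (use F(2) in auto)
  qed
  then show ?thesis
    using F(2) by (simp add: image_comp)
qed

section \<open>Null sets and the Continuum Hypothesis\<close>

text \<open>A closed set \<open>S\<close> fills the complement of \<open>N\<close> up to measure
  less than 1. It is uncountable, since otherwise the remainder would have infinite measure, and so
  it has an uncountable null subset.\<close>

lemma uncountable_null_disjoint:
  fixes N :: "'a::euclidean_space set"
  assumes N: "N \<in> null_sets lebesgue"
  obtains K where "K \<in> null_sets lebesgue" "uncountable K" "K \<inter> N = {}"
proof -
  have "- N \<in> sets lebesgue"
    using N by (simp add: Compl_in_sets_lebesgue null_setsD2)
  then obtain S where S: "closed S" "S \<subseteq> - N" "emeasure lebesgue (- N - S) < ennreal 1"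
    by (rule sets_lebesgue_inner_closed[of _ 1]) auto
  have "uncountable S"
  proof
    assume "countable S"
    then have "N \<union> S \<in> null_sets lebesgue"
      by (intro null_sets.Un[OF N] countable_imp_null_set)
    then have "emeasure lebesgue (UNIV - (N \<union> S)) = emeasure lebesgue (UNIV :: 'a set)"
      by (intro emeasure_Diff_null_set) auto
    moreover have "UNIV - (N \<union> S) = - N - S" by blast
    ultimately show False
      using S(3) by (simp add: emeasure_lborel_UNIV)
  qed
  then have "\<not> (\<forall>K \<in> null_sets lebesgue. countable (id ` {z \<in> S. id z \<in> K}))"
    using countable_image_of_null_preimages[of S id id] S(1)
    by (metis completely_metrizable_space_euclidean continuous_on_id' image_id id_apply)
  then obtain K where K: "K \<in> null_sets lebesgue" "uncountable (S \<inter> K)"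
    by (auto simp: Int_def)
  show ?thesis
  proof
    show "S \<inter> K \<in> null_sets lebesgue"
      using K(1) by (rule null_sets_completion_subset[rotated]) blast
  qed (use K(2) S(2) in auto)
qed

text \<open>A set \<open>S\<close> of naturals codes a sequence of open sets:
  \<open>prod_encode (k, i) \<in> S\<close> puts the \<open>i\<close>-th basic set into the
  \<open>k\<close>-th open set. Indexing by \<open>nat set\<close> gives a family of size continuum,
  which CH can well-order.\<close>

lemma null_sets_cofinal_family:
  obtains b :: "nat set \<Rightarrow> 'a::euclidean_space set"
  where "\<And>S. b S \<in> sets borel" "\<And>S. b S \<in> null_sets lebesgue"
    "\<And>N. N \<in> null_sets lebesgue \<Longrightarrow> \<exists>S. N \<subseteq> b S"
proof -
  obtain \<B> :: "'a set set" where \<B>: "countable \<B>" "topological_basis \<B>"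
    using ex_countable_basis by blast
  define e where "e = from_nat_into \<B>"
  have "\<B> \<noteq> {}"
    using topological_basisE[OF \<B>(2) open_UNIV, of undefined] by blast
  then have e: "range e = \<B>"
    unfolding e_def using \<B>(1) by (rule range_from_nat_into)
  define G where "G S = (\<Inter>k. \<Union>i\<in>{i. prod_encode (k, i) \<in> S}. e i)" for S
  \<comment> \<open>Codes whose intersection is not null get the default \<open>{}\<close>, so every
    member of the family is null.\<close>
  define b where "b S = (if G S \<in> null_sets lebesgue then G S else {})" for S
  have "open (e i)" for i
    using e \<B>(2) by (metis rangeI topological_basis_open)
  then have "G S \<in> sets borel" for S
    unfolding G_def by (intro sets.countable_INT'') auto
  then have "b S \<in> sets borel" for S
    unfolding b_def by simp
  moreover have "b S \<in> null_sets lebesgue" for S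
    unfolding b_def by simp
  moreover have "\<exists>S. N \<subseteq> b S" if N: "N \<in> null_sets lebesgue" for N :: "'a set"
  proof -
    obtain V :: "nat \<Rightarrow> 'a set"
      where V: "\<And>k. open (V k)" "\<And>k. N \<subseteq> V k" "(\<Inter>k. V k) \<in> null_sets lebesgue"
      using null_set_gdelta_cover[OF N] by blast
    have "\<exists>I. V k = (\<Union>i\<in>I. e i)" for k
      using V(1)[of k] \<B>(2) e unfolding topological_basis_def by (metis subset_image_iff)
    then obtain I where I: "\<And>k. V k = (\<Union>i\<in>I k. e i)" by metis
    define S where "S = prod_encode ` (SIGMA k:UNIV. I k)"
    have "{i. prod_encode (k, i) \<in> S} = I k" for k
      unfolding S_def by (auto dest: prod_encode_eq[THEN iffD1])
    then have "G S = (\<Inter>k. V k)"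
      unfolding G_def using I by simp
    then have "N \<subseteq> b S"
      using V unfolding b_def by auto
    then show ?thesis ..
  qed
  ultimately show ?thesis using that by blast
qed

context
  includes cardinal_syntax
begin

lemma continuum_hypothesis_imp_cardSuc:
  assumes continuum_hypothesis
  shows "ordIso2 |UNIV :: nat set set| (cardSuc natLeq)"
proof -
  have "ctwo ^c natLeq = |Func (UNIV :: nat set) (UNIV :: bool set)|"
    by (simp add: cexp_def ctwo_def Field_natLeq Field_card_of)
  then have "ordIso2 |Pow (UNIV :: nat set)| (ctwo ^c natLeq)"
    using card_of_Pow_Func by metis
  then show ?thesis
    using assms ordIso_transitive unfolding continuum_hypothesis_def Pow_UNIV by blast
qed

text \<open>A cardinal order has proper initial segments of smaller cardinality, here below
  \<aleph>-1. The reflexive segment only adds \<open>x\<close>.\<close>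

lemma continuum_hypothesis_countable_segment:
  assumes continuum_hypothesis
  shows "countable {y. (y, x) \<in> |UNIV :: nat set set|}"
proof -
  let ?r = "|UNIV :: nat set set|"
  have "|underS ?r x| <o ?r"
    by (intro card_of_underS card_of_Card_order) (simp add: Field_card_of)
  then have "|underS ?r x| <o cardSuc natLeq"
    using continuum_hypothesis_imp_cardSuc[OF assms] by (rule ordLess_ordIso_trans)
  then have "|underS ?r x| \<le>o natLeq"
    using cardSuc_ordLeq_ordLess natLeq_Card_order card_of_Card_order by blast
  then have "countable (underS ?r x)"
    by (simp only: countable_card_le_natLeq)
  then have "countable (insert x (underS ?r x))"
    by simp
  then show ?thesis
    by (rule countable_subset[rotated]) (auto simp: underS_def)
qed

text \<open>Under CH an uncountable \<open>X\<close> has full size; this lets the pieces of a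
  partition be labelled by all the reals.\<close>

lemma continuum_hypothesis_uncountable_eqpoll:
  fixes X :: "nat set set"
  assumes continuum_hypothesis "uncountable X"
  shows "X \<approx> (UNIV :: real set)"
proof -
  have "natLeq <o |X|"
    using assms(2) not_ordLeq_iff_ordLess[OF natLeq_Well_order card_of_Well_order[of X]]
    by (simp only: countable_card_le_natLeq)
  then have "cardSuc natLeq \<le>o |X|"
    using cardSuc_ordLess_ordLeq natLeq_Card_order card_of_Card_order by blast
  then have "|UNIV :: nat set set| \<le>o |X|"
    using continuum_hypothesis_imp_cardSuc[OF assms(1)] ordIso_ordLeq_trans by blast
  then have "ordIso2 |X| |UNIV :: nat set set|"
    by (simp add: ordIso_iff_ordLeq card_of_mono1)
  then have "X \<approx> (UNIV :: nat set set)"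
    by (simp add: eqpoll_iff_card_of_ordIso)
  then show ?thesis
    using nat_sets_eqpoll_reals by (rule eqpoll_trans)
qed

end

lemma continuum_hypothesis_null_to_countable:
  assumes CH: continuum_hypothesis
  obtains f :: "'a::euclidean_space \<Rightarrow> real"
  where "\<And>N. N \<in> null_sets lebesgue \<Longrightarrow> countable (f ` N)"
    "\<And>y. uncountable (f -` {y})" "\<And>y. f -` {y} \<in> sets borel" "\<And>y. f -` {y} \<in> null_sets lebesgue"
proof -
  define r where "r = card_of (UNIV :: nat set set)"
  have "Field r = UNIV"
    unfolding r_def by (simp add: Field_card_of)
  have "Well_order r"
    unfolding r_def by (rule card_of_Well_order)
  then interpret wo_rel r by (simp add: wo_rel_def)
  have min: "minim S \<in> S" "\<And>s. s \<in> S \<Longrightarrow> (minim S, s) \<in> r" if "S \<noteq> {}" for S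
    using that \<open>Field r = UNIV\<close> by (auto intro: minim_in minim_least)
  have segment: "countable {y. (y, x) \<in> r}" for x
    unfolding r_def by (rule continuum_hypothesis_countable_segment[OF CH])
  have total: "(x, y) \<in> r \<or> (y, x) \<in> r" for x y
    using TOTALS \<open>Field r = UNIV\<close> by auto

  obtain b :: "nat set \<Rightarrow> 'a set" where b: "\<And>S. b S \<in> sets borel" "\<And>S. b S \<in> null_sets lebesgue"
    "\<And>N. N \<in> null_sets lebesgue \<Longrightarrow> \<exists>S. N \<subseteq> b S"
    using null_sets_cofinal_family by blast
  \<comment> \<open>The fibres of \<open>idx\<close> are the disjointified null sets: each point
    goes to the first member containing it.\<close>
  define idx where "idx x = minim {y. x \<in> b y}" for x
  have idx: "x \<in> b (idx x)" "\<And>y. x \<in> b y \<Longrightarrow> (idx x, y) \<in> r" for x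
  proof -
    have "{y. x \<in> b y} \<noteq> {}"
      using b(3)[OF countable_imp_null_set[of "{x}"]] by auto
    from min[OF this] show "x \<in> b (idx x)" "\<And>y. x \<in> b y \<Longrightarrow> (idx x, y) \<in> r"
      unfolding idx_def by auto
  qed
  have null_idx: "countable (idx ` N)" if N: "N \<in> null_sets lebesgue" for N
  proof -
    obtain S where "N \<subseteq> b S" using b(3)[OF N] by blast
    then have "idx ` N \<subseteq> {y. (y, S) \<in> r}" using idx(2) by blast
    then show ?thesis using segment countable_subset by blast
  qed
  have idx_fiber: "idx -` {z} \<in> sets borel \<and> idx -` {z} \<in> null_sets lebesgue" for z
  proof -
    have "idx -` {z} = b z - (\<Union>y\<in>{y. (y, z) \<in> r} - {z}. b y)"
    proof (intro equalityI subsetI)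
      fix x assume "x \<in> idx -` {z}"
      then show "x \<in> b z - (\<Union>y\<in>{y. (y, z) \<in> r} - {z}. b y)"
        using idx[of x] ANTISYM by (auto dest: antisymD)
    next
      fix x assume x: "x \<in> b z - (\<Union>y\<in>{y. (y, z) \<in> r} - {z}. b y)"
      then show "x \<in> idx -` {z}"
        using idx[of x] by auto
    qed
    moreover have "b z - (\<Union>y\<in>{y. (y, z) \<in> r} - {z}. b y) \<in> sets borel"
      using b(1) segment by (intro sets.Diff sets.countable_UN') auto
    ultimately show ?thesis
      using null_sets_completion_subset[OF _ b(2)[of z]] by auto
  qed

  define X where "X = {z. uncountable (idx -` {z})}"
  \<comment> \<open>Otherwise the uncountable pieces have a null union. An uncountable null
    \<open>K\<close> avoiding it meets only countably many pieces, all of them countable, which is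
    absurd.\<close>
  have X: "uncountable X"
  proof
    assume "countable X"
    then have "(\<Union>z\<in>X. idx -` {z}) \<in> null_sets lebesgue"
      using idx_fiber by (intro null_sets_UN') auto
    then obtain K where K: "K \<in> null_sets lebesgue" "uncountable K" "K \<inter> (\<Union>z\<in>X. idx -` {z}) = {}"
      by (rule uncountable_null_disjoint)
    have "K \<subseteq> (\<Union>z\<in>idx ` K. idx -` {z})" by auto
    moreover have "countable (idx -` {z})" if "z \<in> idx ` K" for z
      using that K(3) unfolding X_def by auto
    then have "countable (\<Union>z\<in>idx ` K. idx -` {z})"
      using null_idx[OF K(1)] by (intro countable_UN)
    ultimately show False
      using K(2) countable_subset by blast
  qed
  \<comment> \<open>Such a next index exists because the uncountable \<open>X\<close> fits in no
    countable initial segment.\<close>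
  define g where "g y = minim {z \<in> X. (y, z) \<in> r}" for y
  have g: "g y \<in> X" "(y, g y) \<in> r" "\<And>z. z \<in> X \<Longrightarrow> (y, z) \<in> r \<Longrightarrow> (g y, z) \<in> r" for y
  proof -
    have "\<not> X \<subseteq> {z. (z, y) \<in> r}"
      using X segment countable_subset by blast
    then have "{z \<in> X. (y, z) \<in> r} \<noteq> {}"
      using total by blast
    from min[OF this] show "g y \<in> X" "(y, g y) \<in> r" "\<And>z. z \<in> X \<Longrightarrow> (y, z) \<in> r \<Longrightarrow> (g y, z) \<in> r"
      unfolding g_def by auto
  qed
  have g_X: "g z = z" if "z \<in> X" for z
    using g[of z] that total[of z z] ANTISYM by (auto dest: antisymD)

  obtain h where h: "bij_betw h X (UNIV :: real set)"
    using continuum_hypothesis_uncountable_eqpoll[OF CH X] unfolding eqpoll_def by blast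
  define f where "f = h \<circ> g \<circ> idx"
  have fiber: "\<exists>z\<in>X. f -` {v} = (\<Union>y\<in>{y. g y = z}. idx -` {y})" for v
  proof -
    obtain z where z: "z \<in> X" "h z = v"
      using h by (metis UNIV_I bij_betw_imp_surj_on imageE)
    then have "h (g y) = v \<longleftrightarrow> g y = z" for y
      using g(1)[of y] h by (metis bij_betw_imp_inj_on inj_onD)
    then show ?thesis
      using z(1) unfolding f_def by (intro bexI[of _ z] set_eqI) simp_all
  qed
  \<comment> \<open>All indices merged into \<open>z\<close> precede or equal \<open>z\<close>, so a
    fibre of \<open>f\<close> is a countable union of Borel null sets.\<close>
  have group: "countable {y. g y = z}" for z
    using g(2) by (intro countable_subset[OF _ segment[of z]]) auto
  show ?thesis
  proof
    fix N :: "'a set" assume "N \<in> null_sets lebesgue"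
    then show "countable (f ` N)"
      using countable_image[OF null_idx, of N "h \<circ> g"] by (simp add: f_def image_comp)
  next
    fix v :: real
    obtain z where z: "z \<in> X" "f -` {v} = (\<Union>y\<in>{y. g y = z}. idx -` {y})"
      by (rule bexE[OF fiber[of v]])
    have sub: "idx -` {z} \<subseteq> f -` {v}"
      unfolding z(2) using g_X[OF z(1)] by blast
    show "uncountable (f -` {v})"
      using z(1) countable_subset[OF sub] unfolding X_def by blast
    show "f -` {v} \<in> sets borel"
      unfolding z(2) using group idx_fiber by (intro sets.countable_UN') auto
    show "f -` {v} \<in> null_sets lebesgue"
      unfolding z(2) using group idx_fiber by (intro null_sets_UN') auto
  qed
qed

theorem theorem8p1:
  shows
    "(\<forall>(A :: real set) (f :: real \<Rightarrow> real).
        A \<notin> null_sets lebesgue \<and> analytic_set A \<and> continuous_on UNIV f \<and>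
        (\<forall>N. N \<subseteq> A \<and> N \<in> null_sets lebesgue \<longrightarrow> countable (f ` N)) \<longrightarrow>
        countable (f ` A) \<and> (is_interval A \<longrightarrow> f constant_on A))
     \<and>
     (continuum_hypothesis \<longrightarrow>
       (\<exists>f :: real \<Rightarrow> real.
          (\<forall>N. N \<in> null_sets lebesgue \<longrightarrow> countable (f ` N)) \<and>
          range f = UNIV \<and>
          (\<forall>A. A \<notin> null_sets lebesgue \<longrightarrow> uncountable (f ` A)) \<and>
          (\<forall>y. uncountable (f -` {y}) \<and> f -` {y} \<in> sets borel \<and> f -` {y} \<in> null_sets lebesgue)))
     \<and>
     (\<forall>(A :: real set) (f :: real \<Rightarrow> real).
        A \<notin> null_sets lebesgue \<and> continuous_on UNIV f \<and>
        (\<forall>N. N \<subseteq> A \<and> N \<in> null_sets lebesgue \<longrightarrow> meager (f ` N)) \<longrightarrow>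
        meager (f ` A) \<and> (is_interval A \<longrightarrow> f constant_on A))
     \<and>
     (\<forall>f :: real \<Rightarrow> real.
        f \<in> borel_measurable lebesgue \<and>
        (\<forall>N. N \<in> null_sets lebesgue \<longrightarrow> meager (f ` N)) \<longrightarrow>
        meager (range f) \<and> (continuous_on UNIV f \<longrightarrow> f constant_on UNIV))
     \<and>
     (\<forall>f :: real \<Rightarrow> real.
        baire_property_fun f \<and>
        (\<forall>M. meager M \<longrightarrow> f ` M \<in> null_sets lebesgue) \<longrightarrow>
        range f \<in> null_sets lebesgue \<and> (continuous_on UNIV f \<longrightarrow> f constant_on UNIV))"
proof (intro conjI allI impI)
  fix A :: "real set" and f :: "real \<Rightarrow> real"
  assume "A \<notin> null_sets lebesgue \<and> analytic_set A \<and> continuous_on UNIV f \<and>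
    (\<forall>N. N \<subseteq> A \<and> N \<in> null_sets lebesgue \<longrightarrow> countable (f ` N))"
  then have A: "analytic_set A" and f: "continuous_on UNIV f"
    and null: "\<And>N. N \<subseteq> A \<Longrightarrow> N \<in> null_sets lebesgue \<Longrightarrow> countable (f ` N)"
    by auto
  show "countable (f ` A)"
    using A continuous_on_subset[OF f subset_UNIV] null by (rule countable_image_of_analytic)
  then show "f constant_on A" if "is_interval A"
    using f that by (intro continuous_constant_on_interval interior_null_set countable_imp_null_set)
next
  assume CH: continuum_hypothesis
  obtain f :: "real \<Rightarrow> real" where f:
    "\<And>N. N \<in> null_sets lebesgue \<Longrightarrow> countable (f ` N)" "\<And>y. uncountable (f -` {y})"
    "\<And>y. f -` {y} \<in> sets borel" "\<And>y. f -` {y} \<in> null_sets lebesgue"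
    using continuum_hypothesis_null_to_countable[OF CH] by blast
  have "y \<in> range f" for y
  proof -
    have "f -` {y} \<noteq> {}"
      using f(2)[of y] by (metis countable_empty)
    then show ?thesis by blast
  qed
  then have "range f = UNIV" by blast
  moreover have "uncountable (f ` A)" if "A \<notin> null_sets lebesgue" for A
  proof
    assume "countable (f ` A)"
    \<comment> \<open>A set with countable image is covered by countably many null fibres.\<close>
    then have "(\<Union>y\<in>f ` A. f -` {y}) \<in> null_sets lebesgue"
      using f(4) by (intro null_sets_UN')
    then have "A \<in> null_sets lebesgue"
      by (rule null_sets_completion_subset[rotated]) blast
    with that show False ..
  qed
  ultimately show "\<exists>f :: real \<Rightarrow> real.
      (\<forall>N. N \<in> null_sets lebesgue \<longrightarrow> countable (f ` N)) \<and>
      range f = UNIV \<and>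
      (\<forall>A. A \<notin> null_sets lebesgue \<longrightarrow> uncountable (f ` A)) \<and>
      (\<forall>y. uncountable (f -` {y}) \<and> f -` {y} \<in> sets borel \<and> f -` {y} \<in> null_sets lebesgue)"
    using f by (intro exI[of _ f]) simp
next
  fix A :: "real set" and f :: "real \<Rightarrow> real"
  assume "A \<notin> null_sets lebesgue \<and> continuous_on UNIV f \<and>
    (\<forall>N. N \<subseteq> A \<and> N \<in> null_sets lebesgue \<longrightarrow> meager (f ` N))"
  then have f: "continuous_on UNIV f"
    and null: "\<And>N. N \<subseteq> A \<Longrightarrow> N \<in> null_sets lebesgue \<Longrightarrow> meager (f ` N)"
    by auto
  have "f \<in> borel_measurable lebesgue"
    using borel_measurable_continuous_onI[OF f] by (intro measurable_completion) simp
  then show "meager (f ` A)"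
    using null by (rule meager_image_of_null_to_meager)
  then show "f constant_on A" if "is_interval A"
    using f that by (intro continuous_constant_on_interval interior_meager)
next
  fix f :: "real \<Rightarrow> real"
  assume "f \<in> borel_measurable lebesgue \<and> (\<forall>N. N \<in> null_sets lebesgue \<longrightarrow> meager (f ` N))"
  then show "meager (range f)"
    using meager_image_of_null_to_meager by blast
  then show "f constant_on UNIV" if "continuous_on UNIV f"
    using that by (intro continuous_constant_on_interval interior_meager is_interval_univ)
next
  fix f :: "real \<Rightarrow> real"
  assume "baire_property_fun f \<and> (\<forall>M. meager M \<longrightarrow> f ` M \<in> null_sets lebesgue)"
  then show "range f \<in> null_sets lebesgue"
    using null_range_of_meager_to_null by blast
  then show "f constant_on UNIV" if "continuous_on UNIV f"
    using that by (intro continuous_constant_on_interval interior_null_set is_interval_univ)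
qed

end
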